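(* Every topological space $(X,\tau)$ has a largest (with respect to inclusion) $\omega$-perfect subset $P_\omega$, which is closed. The complement $X\setminus P_\omega$ is open and (as a subspace) $\omega$-scattered. In particular, $(X,\tau)$ is $\omega$-scattered if and only if $P_\omega=\emptyset$.
   Context: For a topological space $(X,\tau)$ and $A\subseteq X$, $\omega(A)$ is the set of $\omega$-accumulation points of $A$, i.e. of points $x\in X$ such that $|U\cap A|\ge\aleph_0$ for every open set $U$ containing $x$. A closed subset $P\subseteq X$ is $\omega$-perfect if $P\subseteq\omega(P)$. A topological space is $\omega$-scattered if it contains no non-empty $\omega$-perfect subset. *)

theory Defs
  imports "HOL-Analysis.Abstract_Topology"
begin

(* A set has cardinality at least aleph_0 iff it is infinite. *)
definition omega_accumulation_points :: "'a topology \<Rightarrow> 'a set \<Rightarrow> 'a set" where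
  "omega_accumulation_points X A =
     {x \<in> topspace X. \<forall>U. openin X U \<and> x \<in> U \<longrightarrow> infinite (U \<inter> A)}"

definition omega_perfect :: "'a topology \<Rightarrow> 'a set \<Rightarrow> bool" where
  "omega_perfect X P \<longleftrightarrow> closedin X P \<and> P \<subseteq> omega_accumulation_points X P"

definition omega_scattered :: "'a topology \<Rightarrow> bool" where
  "omega_scattered X \<longleftrightarrow> \<not> (\<exists>P. P \<noteq> {} \<and> omega_perfect X P)"

end

theory Submission
  imports Defs
begin

text \<open>
  Call a set \<open>A\<close> \<^emph>\<open>\<omega>-crowded\<close> when every point of \<open>A\<close> is an \<open>\<omega>\<close>-accumulation
  point of \<open>A\<close>, so that \<open>\<omega>\<close>-perfect means closed and \<open>\<omega>\<close>-crowded. An arbitrary union of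
  \<open>\<omega>\<close>-crowded sets is \<open>\<omega>\<close>-crowded, because enlarging \<open>A\<close> only enlarges its set of
  \<open>\<omega>\<close>-accumulation points. That set is moreover closed, so the closure of an
  \<open>\<omega>\<close>-crowded set is again \<open>\<omega>\<close>-crowded, hence \<open>\<omega>\<close>-perfect
  (\<open>omega_perfect_closure_of\<close>). The closure \<open>P\<close> of the union of all \<open>\<omega>\<close>-perfect sets is
  therefore the largest one.

  Passing from a subspace to the whole space keeps a set \<open>\<omega>\<close>-crowded, while it may stop
  being closed. Taking the closure repairs this: the closure of an \<open>\<omega>\<close>-perfect subset of
  the complement of \<open>P\<close> is \<open>\<omega>\<close>-perfect in the whole space, hence lies in \<open>P\<close>, and
  so the subset was empty.
\<close>

lemma omega_accumulation_points_mono: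
  assumes "A \<subseteq> B"
  shows "omega_accumulation_points X A \<subseteq> omega_accumulation_points X B"
proof -
  have "infinite (U \<inter> B)" if "infinite (U \<inter> A)" for U
    using that infinite_super[of "U \<inter> A" "U \<inter> B"] assms by blast
  then show ?thesis
    unfolding omega_accumulation_points_def by blast
qed

text \<open>A point that is no \<open>\<omega>\<close>-accumulation point has a neighbourhood with finite trace on
  \<open>A\<close>, and the same neighbourhood witnesses this for each of its points.\<close>

lemma closedin_omega_accumulation_points:
  "closedin X (omega_accumulation_points X A)"
  unfolding closedin_def
proof
  show "omega_accumulation_points X A \<subseteq> topspace X"
    unfolding omega_accumulation_points_def by blast
  have "topspace X - omega_accumulation_points X A = \<Union>{U. openin X U \<and> finite (U \<inter> A)}"
    unfolding omega_accumulation_points_def by (auto dest: openin_subset)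
  then show "openin X (topspace X - omega_accumulation_points X A)"
    by (auto intro: openin_Union)
qed

lemma omega_perfect_closure_of:
  assumes "A \<subseteq> omega_accumulation_points X A"
  shows "omega_perfect X (X closure_of A)"
proof -
  have "A \<subseteq> topspace X"
    using assms unfolding omega_accumulation_points_def by blast
  then have "A \<subseteq> X closure_of A"
    by (rule closure_of_subset)
  then have "omega_accumulation_points X A \<subseteq> omega_accumulation_points X (X closure_of A)"
    by (rule omega_accumulation_points_mono)
  moreover have "X closure_of A \<subseteq> omega_accumulation_points X A"
    using assms closedin_omega_accumulation_points by (rule closure_of_minimal)
  ultimately show ?thesis
    unfolding omega_perfect_def by auto
qed

text \<open>An open set \<open>U\<close> of the whole space cuts out the open set \<open>U \<inter> S\<close> of the subspace,
  and if already \<open>U \<inter> S\<close> contains infinitely many points of \<open>A\<close>, then so does \<open>U\<close>.\<close>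

lemma omega_accumulation_points_subtopology_subset:
  "omega_accumulation_points (subtopology X S) A \<subseteq> omega_accumulation_points X A"
proof
  fix x assume x: "x \<in> omega_accumulation_points (subtopology X S) A"
  then have xX: "x \<in> topspace X" and xS: "x \<in> S"
    unfolding omega_accumulation_points_def by auto
  have "infinite (U \<inter> A)" if U: "openin X U" "x \<in> U" for U
  proof -
    have "openin (subtopology X S) (U \<inter> S)"
      using U(1) by (rule openin_subtopology_Int)
    then have "infinite (U \<inter> S \<inter> A)"
      using x xS U(2) unfolding omega_accumulation_points_def by blast
    then show ?thesis
      using infinite_super[of "U \<inter> S \<inter> A" "U \<inter> A"] by blast
  qed
  with xX show "x \<in> omega_accumulation_points X A"
    unfolding omega_accumulation_points_def by blast
qed

lemma Union_omega_perfect_subset_accumulation_points: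
  "\<Union>{Q. omega_perfect X Q} \<subseteq> omega_accumulation_points X (\<Union>{Q. omega_perfect X Q})"
proof (rule Union_least)
  fix Q assume Q: "Q \<in> {Q. omega_perfect X Q}"
  then have "Q \<subseteq> omega_accumulation_points X Q"
    unfolding omega_perfect_def by blast
  also have "\<dots> \<subseteq> omega_accumulation_points X (\<Union>{Q. omega_perfect X Q})"
    by (rule omega_accumulation_points_mono) (use Q in blast)
  finally show "Q \<subseteq> omega_accumulation_points X (\<Union>{Q. omega_perfect X Q})" .
qed

theorem theorem6p14:
  fixes X :: "'a topology"
  shows "\<exists>P. omega_perfect X P \<and> (\<forall>Q. omega_perfect X Q \<longrightarrow> Q \<subseteq> P) \<and>
           closedin X P \<and>
           openin X (topspace X - P) \<and>
           omega_scattered (subtopology X (topspace X - P)) \<and>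
           (omega_scattered X \<longleftrightarrow> P = {})"
proof -
  define P where "P = X closure_of \<Union>{Q. omega_perfect X Q}"
  have perfect: "omega_perfect X P"
    unfolding P_def
    by (rule omega_perfect_closure_of) (rule Union_omega_perfect_subset_accumulation_points)
  have largest: "Q \<subseteq> P" if "omega_perfect X Q" for Q
  proof -
    have "\<Union>{Q. omega_perfect X Q} \<subseteq> P"
      unfolding P_def
      by (rule closure_of_subset) (auto simp: omega_perfect_def dest: closedin_subset)
    with that show ?thesis by blast
  qed
  have closed: "closedin X P"
    using perfect unfolding omega_perfect_def by blast
  have "Q = {}" if Q: "omega_perfect (subtopology X (topspace X - P)) Q" for Q
  proof -
    have disjoint: "Q \<subseteq> topspace X - P"
      using Q closedin_subset[of "subtopology X (topspace X - P)" Q]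
      by (simp add: omega_perfect_def)
    have "Q \<subseteq> omega_accumulation_points X Q"
      using Q unfolding omega_perfect_def
      by (meson omega_accumulation_points_subtopology_subset order_trans)
    then have "X closure_of Q \<subseteq> P"
      by (intro largest omega_perfect_closure_of)
    moreover have "Q \<subseteq> X closure_of Q"
      using disjoint by (intro closure_of_subset) blast
    ultimately show ?thesis
      using disjoint by blast
  qed
  then have scattered: "omega_scattered (subtopology X (topspace X - P))"
    unfolding omega_scattered_def by blast
  have iff: "omega_scattered X \<longleftrightarrow> P = {}"
  proof
    show "P = {}" if "omega_scattered X"
      using that perfect unfolding omega_scattered_def by blast
    show "omega_scattered X" if "P = {}"
      unfolding omega_scattered_def using largest that by (metis subset_empty)
  qed
  have "openin X (topspace X - P)"
    using closed by (simp add: closedin_def)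
  with perfect largest closed scattered iff show ?thesis
    by (intro exI[of _ P]) simp
qed

end
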